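(* Let $\kappa\leq\mu$ and $\lambda$ be infinite cardinals. If there is a $\kappa$-barely independent family over $\mu$ of size $\lambda$, then $\mathfrak{r}(\kappa,\lambda)\geq \mathrm{cof}(\mu)$.
   Context: Notation: for a set $X$ and $A\subseteq X$, put $A^0=A$ and $A^1=X\setminus A$. For a family $\mathcal{A}$ of subsets of $X$ and $h:\mathcal{A}\to 2=\{0,1\}$, put $\mathcal{A}^h=\{A^{h(A)} : A\in\mathcal{A}\}$. The intersection of the empty family of subsets of $X$ is $X$. For a cardinal $\nu$, $[X]^{\nu}$ (resp. $[X]^{<\nu}$) is the set of subsets of $X$ of cardinality $\nu$ (resp. less than $\nu$). Definition: let $\kappa\leq\mu$ be infinite cardinals and let $\mathcal{I}\subseteq[\mu]^{\mu}$. The family $\mathcal{I}$ is called $\kappa$-barely independent over $\mu$ if $|\mathcal{I}|\geq\kappa$ and (i) $|\bigcap\mathcal{A}^h|=\mu$ for every $\mathcal{A}\in[\mathcal{I}]^{<\kappa}$ and every $h:\mathcal{A}\to 2$; (ii) $|\bigcap\mathcal{A}^h|<\mu$ for every $\mathcal{A}\in[\mathcal{I}]^{\kappa}$ and every $h:\mathcal{A}\to 2$. For infinite sets $R,S$, $S$ splits $R$ if both $R\cap S$ and $R\setminus S$ are infinite; otherwise $R$ reaps $S$. For infinite cardinals $\kappa\leq\lambda$, $\mathfrak{r}(\kappa,\lambda)$ is the minimum size of a family $\mathcal{R}\subseteq[\lambda]^{\kappa}$ such that every infinite $S\subseteq\lambda$ is reaped by at least one member of $\mathcal{R}$. (A $\kappa$-barely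 independent family of size $\lambda$ has $\lambda\geq\kappa$ by definition.) *)

theory Defs
  imports Main "HOL-Library.FuncSet"
begin

unbundle cardinal_syntax

text \<open>
  An infinite cardinal is represented, as in the library, by a relation \<open>r\<close> with
  \<^term>\<open>Cinfinite r\<close>: an infinite well-order of minimal order type, identified with its
  underlying set \<^term>\<open>Field r\<close>. Cardinals may live on different types; they are compared
  by \<open>=o\<close>, \<open>\<le>o\<close> and \<open><o\<close>.
\<close>

definition subsets_of_card :: "'a set \<Rightarrow> 'b rel \<Rightarrow> 'a set set" where
  "subsets_of_card X \<nu> = {A. A \<subseteq> X \<and> |A| =o \<nu>}"

definition subsets_of_card_less :: "'a set \<Rightarrow> 'b rel \<Rightarrow> 'a set set" where
  "subsets_of_card_less X \<nu> = {A. A \<subseteq> X \<and> |A| <o \<nu>}"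

definition set_power :: "'a set \<Rightarrow> 'a set \<Rightarrow> nat \<Rightarrow> 'a set" where
  "set_power X A i = (if i = 0 then A else X - A)"

definition family_power :: "'a set \<Rightarrow> 'a set set \<Rightarrow> ('a set \<Rightarrow> nat) \<Rightarrow> 'a set set" where
  "family_power X \<A> h = {set_power X A (h A) | A. A \<in> \<A>}"

text \<open>Intersecting with \<open>X\<close> makes the intersection of the empty family equal to \<open>X\<close>;
  for nonempty families of subsets of \<open>X\<close> it has no effect.\<close>

definition Inter_in :: "'a set \<Rightarrow> 'a set set \<Rightarrow> 'a set" where
  "Inter_in X \<B> = X \<inter> \<Inter>\<B>"

definition barely_independent :: "'k rel \<Rightarrow> 'm rel \<Rightarrow> 'm set set \<Rightarrow> bool" where
  "barely_independent \<kappa> \<mu> \<I> \<longleftrightarrow>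
     \<I> \<subseteq> subsets_of_card (Field \<mu>) \<mu> \<and>
     \<kappa> \<le>o |\<I>| \<and>
     (\<forall>\<A> \<in> subsets_of_card_less \<I> \<kappa>. \<forall>h \<in> \<A> \<rightarrow> {0, 1}.
        |Inter_in (Field \<mu>) (family_power (Field \<mu>) \<A> h)| =o \<mu>) \<and>
     (\<forall>\<A> \<in> subsets_of_card \<I> \<kappa>. \<forall>h \<in> \<A> \<rightarrow> {0, 1}.
        |Inter_in (Field \<mu>) (family_power (Field \<mu>) \<A> h)| <o \<mu>)"

definition splits :: "'a set \<Rightarrow> 'a set \<Rightarrow> bool" where
  "splits S R \<longleftrightarrow> infinite (R \<inter> S) \<and> infinite (R - S)"

definition reaps :: "'a set \<Rightarrow> 'a set \<Rightarrow> bool" where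
  "reaps R S \<longleftrightarrow> \<not> splits S R"

definition reaping_family :: "'k rel \<Rightarrow> 'l rel \<Rightarrow> 'l set set \<Rightarrow> bool" where
  "reaping_family \<kappa> \<Lambda> \<R> \<longleftrightarrow>
     \<R> \<subseteq> subsets_of_card (Field \<Lambda>) \<kappa> \<and>
     (\<forall>S. S \<subseteq> Field \<Lambda> \<and> infinite S \<longrightarrow> (\<exists>R \<in> \<R>. reaps R S))"

text \<open>The least size of a member of \<open>\<C>\<close>. It is determined up to \<open>=o\<close>, and meaningful only
  if \<open>\<C>\<close> is nonempty.\<close>

definition min_size :: "'a set set \<Rightarrow> 'a rel" where
  "min_size \<C> = (SOME r. r \<in> card_of ` \<C> \<and> (\<forall>A \<in> \<C>. r \<le>o |A| ))"

definition reaping_number :: "'k rel \<Rightarrow> 'l rel \<Rightarrow> 'l set rel" where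
  "reaping_number \<kappa> \<Lambda> = min_size {\<R>. reaping_family \<kappa> \<Lambda> \<R>}"

text \<open>The library's \<^const>\<open>cofinal\<close> asks for strict upper bounds, which for an infinite
  cardinal amounts to unboundedness.\<close>

definition cof :: "'a rel \<Rightarrow> 'a rel" where
  "cof \<mu> = min_size {A. A \<subseteq> Field \<mu> \<and> cofinal A \<mu>}"

text \<open>The minima in \<^const>\<open>cof\<close> and \<^const>\<open>reaping_number\<close> are attained.\<close>

lemma min_size:
  assumes "\<C> \<noteq> {}"
  shows "min_size \<C> \<in> card_of ` \<C> \<and> (\<forall>A \<in> \<C>. min_size \<C> \<le>o |A| )"
proof -
  have "\<exists>r \<in> card_of ` \<C>. \<forall>r' \<in> card_of ` \<C>. r \<le>o r'"
    using assms by (intro exists_minim_Card_order) (auto simp: card_of_Card_order)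
  then have "\<exists>r. r \<in> card_of ` \<C> \<and> (\<forall>A \<in> \<C>. r \<le>o |A| )"
    by blast
  then show ?thesis
    unfolding min_size_def by (rule someI_ex)
qed

lemma cofinal_Field:
  assumes "Cinfinite \<mu>"
  shows "cofinal (Field \<mu>) \<mu>"
  using assms infinite_Card_order_limit[of \<mu>] unfolding cofinal_def cinfinite_def by blast

lemma reaping_family_all_subsets:
  assumes \<kappa>: "Cinfinite \<kappa>" and \<Lambda>: "Cinfinite \<Lambda>" and le: "\<kappa> \<le>o \<Lambda>"
  shows "reaping_family \<kappa> \<Lambda> (subsets_of_card (Field \<Lambda>) \<kappa>)"
proof -
  have ex: "\<exists>R \<subseteq> B. |R| =o \<kappa>" if "\<kappa> \<le>o |B|" for B :: "'b set"
  proof -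
    have "|Field \<kappa>| \<le>o |B|"
      using \<kappa> that ordIso_ordLeq_trans[OF card_of_Field_ordIso] by blast
    then obtain R where "R \<subseteq> B" "|Field \<kappa>| =o |R|"
      using internalize_card_of_ordLeq2 by blast
    then show ?thesis
      using \<kappa> ordIso_transitive[OF ordIso_symmetric card_of_Field_ordIso] by blast
  qed
  have "\<exists>R \<in> subsets_of_card (Field \<Lambda>) \<kappa>. reaps R S" if S: "S \<subseteq> Field \<Lambda>" for S
  proof -
    have "\<kappa> \<le>o |S| \<or> \<kappa> \<le>o |Field \<Lambda> - S|"
    proof (rule ccontr)
      assume "\<not> ?thesis"
      then have "|S| <o \<kappa>" "|Field \<Lambda> - S| <o \<kappa>"
        using \<kappa> not_ordLeq_iff_ordLess[OF card_of_Well_order card_order_on_well_order_on] by auto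
      then have "|S| <o \<Lambda>" "|Field \<Lambda> - S| <o \<Lambda>"
        using ordLess_ordLeq_trans[OF _ le] by auto
      then have "|S \<union> (Field \<Lambda> - S)| <o \<Lambda>"
        using \<Lambda> card_of_Un_ordLess_infinite_Field[of \<Lambda> S "Field \<Lambda> - S"]
        by (simp add: cinfinite_def)
      moreover have "S \<union> (Field \<Lambda> - S) = Field \<Lambda>"
        using S by blast
      ultimately have "|Field \<Lambda>| <o \<Lambda>"
        by simp
      then show False
        using \<Lambda> not_ordLess_ordIso card_of_Field_ordIso[of \<Lambda>] by blast
    qed
    then obtain R where "R \<subseteq> S \<or> R \<subseteq> Field \<Lambda> - S" and R: "|R| =o \<kappa>"
      using ex[of S] ex[of "Field \<Lambda> - S"] by auto
    then have empty: "R - S = {} \<or> R \<inter> S = {}" and "R \<subseteq> Field \<Lambda>"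
      using S by blast+
    from empty have "finite (R - S) \<or> finite (R \<inter> S)"
      by (metis finite.emptyI)
    then have "reaps R S"
      unfolding reaps_def splits_def by blast
    then show ?thesis
      using R \<open>R \<subseteq> Field \<Lambda>\<close> unfolding subsets_of_card_def by blast
  qed
  then show ?thesis
    unfolding reaping_family_def by blast
qed

end

theory Submission
  imports Defs
begin

text \<open>
  Let \<open>\<R>\<close> be a reaping family. Finitely many infinite sets are always split by a single set,
  so \<open>\<R>\<close> is infinite. Cut each \<open>R \<in> \<R>\<close> into countably many disjoint pieces \<open>R\<^sub>n\<close> of size \<open>\<kappa>\<close>.
  Index the barely independent family as \<open>\<phi> i\<close>, \<open>i < \<lambda>\<close>. For a point \<open>x\<close> of \<open>\<mu>\<close>, the set
  \<open>S = {i. x \<in> \<phi> i}\<close> is reaped by some \<open>R\<close>: one of \<open>R - S\<close> and \<open>R \<inter> S\<close> is finite, hence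
  disjoint from some piece \<open>R\<^sub>n\<close>; thus \<open>x\<close> lies in all the sets \<open>\<phi> i\<close>, \<open>i \<in> R\<^sub>n\<close>, or in all their
  complements. So \<open>\<mu>\<close> is a union of \<open>|\<R>| \<cdot> \<aleph>\<^sub>0 \<cdot> 2 = |\<R>|\<close> sets of size less than \<open>\<mu>\<close>, whence
  \<open>|\<R>|\<close> is at least the cofinality of \<open>\<mu>\<close>. Using pieces instead of the \<open>\<kappa>\<close> many cofinite
  subsets of \<open>R\<close> keeps the number of sets independent of \<open>\<kappa>\<close>.
\<close>

section \<open>Cutting an infinite set into countably many pieces\<close>

text \<open>Since |R| absorbs a countable factor, the rows of \<open>UNIV \<times> R\<close> can be
  carried into \<open>R\<close> by a bijection.\<close>

lemma infinite_nat_partition: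
  assumes "infinite R"
  obtains P :: "nat \<Rightarrow> 'a set"
  where "\<And>n. P n \<subseteq> R" "\<And>n. |P n| =o |R|" "\<And>m n. m \<noteq> n \<Longrightarrow> P m \<inter> P n = {}"
proof -
  have "|UNIV :: nat set| \<le>o |R|"
    using assms infinite_iff_card_of_nat by blast
  then have "|(UNIV :: nat set) \<times> R| =o |R|"
    using assms card_of_Times_infinite[of R "UNIV :: nat set"] by blast
  then obtain g where g: "bij_betw g ((UNIV :: nat set) \<times> R) R"
    using card_of_ordIso by blast
  show ?thesis
  proof (rule that[of "\<lambda>n. g ` ({n} \<times> R)"])
    fix m n :: nat
    show "g ` ({n} \<times> R) \<subseteq> R"
      using g by (auto simp: bij_betw_def)
    have "bij_betw (\<lambda>x. g (n, x)) R (g ` ({n} \<times> R))"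
      using g by (auto simp: bij_betw_def inj_on_def)
    then show "|g ` ({n} \<times> R)| =o |R|"
      using card_of_ordIso ordIso_symmetric by blast
    show "g ` ({m} \<times> R) \<inter> g ` ({n} \<times> R) = {}" if "m \<noteq> n"
      using g that by (auto simp: bij_betw_def inj_on_def)
  qed
qed

lemma finite_meets_finitely_many:
  fixes P :: "nat \<Rightarrow> 'a set"
  assumes "finite F" and disj: "\<And>m n. m \<noteq> n \<Longrightarrow> P m \<inter> P n = {}"
  shows "\<exists>n. P n \<inter> F = {}"
proof (rule ccontr)
  assume "\<not> ?thesis"
  then have "\<forall>n. \<exists>x. x \<in> P n \<inter> F"
    by blast
  then obtain f where f: "\<And>n. f n \<in> P n \<inter> F"
    by metis
  then have "inj f"
    using disj by (metis IntD1 disjoint_iff injI)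
  moreover have "range f \<subseteq> F"
    using f by blast
  ultimately show False
    using \<open>finite F\<close> finite_subset infinite_UNIV_nat finite_imageD by blast
qed

section \<open>Reaping families are infinite\<close>

lemma infinite_split:
  assumes "infinite C"
  shows "\<exists>T. splits T C"
proof -
  obtain P :: "nat \<Rightarrow> 'a set" where P: "\<And>n. P n \<subseteq> C" "\<And>n. |P n| =o |C|"
    "\<And>m n. m \<noteq> n \<Longrightarrow> P m \<inter> P n = {}"
    using infinite_nat_partition[OF assms] by metis
  have inf: "infinite (P n)" for n
    using P(2)[of n] assms card_of_ordIso_finite by blast
  have "P 0 \<subseteq> C \<inter> P 0" "P 1 \<subseteq> C - P 0"
    using P(1) P(3)[of 0 1] by auto
  then show ?thesis
    unfolding splits_def using inf infinite_super by metis
qed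

text \<open>The members of \<R> generate finitely many atoms. Each member is a union of atoms, so if
  infinite it contains an infinite atom; it suffices to split every infinite atom.\<close>

lemma finite_family_split:
  assumes fin: "finite \<R>" and inf: "\<And>R. R \<in> \<R> \<Longrightarrow> infinite R"
  shows "\<exists>S. \<forall>R \<in> \<R>. splits S R"
proof -
  \<comment> \<open>The nonempty fibres of \<open>f\<close> are the atoms. \<open>T Y\<close> splits
    the atom of \<open>Y\<close> when that is infinite and is arbitrary otherwise; \<open>S\<close>
    glues these sets together.\<close>
  define f where "f x = {R \<in> \<R>. x \<in> R}" for x
  define T where "T Y = (SOME T. splits T (f -` {Y}))" for Y
  have T: "splits (T Y) (f -` {Y})" if "infinite (f -` {Y})" for Y
    unfolding T_def using infinite_split[OF that] by (rule someI_ex)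
  define S where "S = {x. x \<in> T (f x)}"
  have "splits S R" if R: "R \<in> \<R>" for R
  proof -
    have "f ` R \<subseteq> Pow \<R>"
      by (auto simp: f_def)
    then have "finite (f ` R)"
      by (rule finite_subset) (simp add: fin)
    then obtain x where x: "x \<in> R" "infinite {y \<in> R. f y = f x}"
      using pigeonhole_infinite[OF inf[OF R]] by blast
    \<comment> \<open>The whole atom of \<open>x\<close> lies inside \<open>R\<close>, so splitting
      the atom splits \<open>R\<close>.\<close>
    have "y \<in> R" if "f y = f x" for y
    proof -
      have "R \<in> f x"
        using x(1) R by (simp add: f_def)
      then have "R \<in> f y"
        using that by simp
      then show ?thesis
        by (simp add: f_def)
    qed
    then have eq: "{y \<in> R. f y = f x} = f -` {f x}"
      by blast
    have "splits (T (f x)) (f -` {f x})"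
      using T x(2) eq by simp
    moreover have "f -` {f x} \<inter> T (f x) \<subseteq> R \<inter> S" "f -` {f x} - T (f x) \<subseteq> R - S"
      using eq by (auto simp: S_def)
    ultimately show ?thesis
      unfolding splits_def using infinite_super by metis
  qed
  then show ?thesis
    by blast
qed

text \<open>This lets |\<R>| absorb the number of pieces and the two truth values in the final
  count.\<close>

lemma reaping_family_infinite:
  assumes \<kappa>: "Cinfinite \<kappa>" and \<Lambda>: "Cinfinite \<Lambda>" and reap: "reaping_family \<kappa> \<Lambda> \<R>"
  shows "infinite \<R>"
proof
  assume fin: "finite \<R>"
  have R: "R \<subseteq> Field \<Lambda>" "infinite R" if "R \<in> \<R>" for R
  proof -
    have "R \<subseteq> Field \<Lambda>" and "|R| =o |Field \<kappa>|"
      using that reap \<kappa> ordIso_transitive[OF _ ordIso_symmetric[OF card_of_Field_ordIso]]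
      unfolding reaping_family_def subsets_of_card_def by blast+
    then show "R \<subseteq> Field \<Lambda>" "infinite R"
      using \<kappa> card_of_ordIso_finite unfolding cinfinite_def by blast+
  qed
  obtain S where S: "\<And>R. R \<in> \<R> \<Longrightarrow> splits S R"
    using finite_family_split[OF fin] R by blast
  have nonempty: "\<R> \<noteq> {}"
    using reap \<Lambda> unfolding reaping_family_def cinfinite_def by blast
  \<comment> \<open>Reaping is tested on subsets of \<open>Field \<Lambda>\<close> only, so
    \<open>S\<close> is cut down to it.\<close>
  have split: "splits (S \<inter> Field \<Lambda>) R" if "R \<in> \<R>" for R
  proof -
    have "R \<inter> (S \<inter> Field \<Lambda>) = R \<inter> S" "R - S \<inter> Field \<Lambda> = R - S"
      using R(1)[OF that] by blast+
    then show ?thesis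
      using S[OF that] unfolding splits_def by simp
  qed
  then have "infinite (S \<inter> Field \<Lambda>)"
    using nonempty unfolding splits_def by (metis all_not_in_conv finite_Int)
  then show False
    using reap split unfolding reaping_family_def reaps_def by blast
qed

section \<open>Unions of fewer than cof(\<mu>) small sets\<close>

text \<open>Each \<open>B j\<close> has at most the size of a proper initial segment of \<mu>. Fewer
  than cof(\<mu>) such segments lie in a single one, below \<open>b\<close>, so the union is
  controlled by |J| and |underS \<mu> b|, both less than \<mu>.\<close>

lemma card_of_UNION_ordLess_cof:
  assumes \<mu>: "Cinfinite \<mu>" and J: "|J| <o cof \<mu>" and B: "\<And>j. j \<in> J \<Longrightarrow> |B j| <o \<mu>"
  shows "|\<Union>j\<in>J. B j| <o \<mu>"
proof -
  have Co: "Card_order \<mu>" and inf: "infinite (Field \<mu>)"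
    using \<mu> by (auto simp: cinfinite_def)
  then have W: "Well_order \<mu>"
    by (simp add: card_order_on_well_order_on)
  have cof: "cof \<mu> \<le>o |A|" if "A \<subseteq> Field \<mu>" "cofinal A \<mu>" for A
    using min_size[of "{A. A \<subseteq> Field \<mu> \<and> cofinal A \<mu>}"] that unfolding cof_def by blast
  have "cof \<mu> \<le>o \<mu>"
    using cof[OF _ cofinal_Field[OF \<mu>]] ordLeq_ordIso_trans card_of_Field_ordIso[OF Co] by blast
  then have J\<mu>: "|J| <o \<mu>"
    using J ordLess_ordLeq_trans by blast
  have "\<exists>a \<in> Field \<mu>. |B j| \<le>o |underS \<mu> a|" if "j \<in> J" for j
  proof -
    obtain a where a: "a \<in> Field \<mu>" "|B j| =o Restr \<mu> (underS \<mu> a)"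
      using B[OF \<open>j \<in> J\<close>] ordLess_iff_ordIso_Restr[OF W card_of_Well_order] by blast
    have "|Field |B j| | =o |Field (Restr \<mu> (underS \<mu> a))|"
      using card_of_cong[OF a(2)] .
    moreover have "|Field (Restr \<mu> (underS \<mu> a))| \<le>o |underS \<mu> a|"
      by (intro card_of_mono1 Field_Restr_subset)
    ultimately show ?thesis
      using a(1) ordIso_ordLeq_trans by (metis Field_card_of)
  qed
  then obtain a where a: "\<And>j. j \<in> J \<Longrightarrow> a j \<in> Field \<mu>" "\<And>j. j \<in> J \<Longrightarrow> |B j| \<le>o |underS \<mu> (a j)|"
    by metis
  have "\<not> cofinal (a ` J) \<mu>"
  proof
    assume "cofinal (a ` J) \<mu>"
    then have "cof \<mu> \<le>o |a ` J|"
      using cof a(1) by blast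
    then have "cof \<mu> \<le>o |J|"
      using card_of_image ordLeq_transitive by blast
    then show False
      using J not_ordLess_ordLeq by blast
  qed
  then obtain b where b: "b \<in> Field \<mu>" "\<And>j. j \<in> J \<Longrightarrow> b = a j \<or> (b, a j) \<notin> \<mu>"
    unfolding cofinal_def by blast
  have bound: "|B j| \<le>o |underS \<mu> b|" if "j \<in> J" for j
  proof -
    have "(a j, b) \<in> \<mu>"
      using b a(1)[OF that] that W
      by (metis well_order_on_def linear_order_on_def partial_order_on_def preorder_on_def
          refl_on_def total_on_def)
    then have "underS \<mu> (a j) \<subseteq> underS \<mu> b"
      using W underS_incr[of \<mu> "a j" b]
      by (simp add: well_order_on_def linear_order_on_def partial_order_on_def preorder_on_def)
    then show ?thesis
      using a(2)[OF that] card_of_mono1 ordLeq_transitive by blast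
  qed
  \<comment> \<open>One bound for both the index set and every \<open>B j\<close>. The union
    estimate needs it infinite; it is finite, for instance, when \<mu> is countable.\<close>
  let ?K = "J <+> underS \<mu> b"
  have K: "|?K| <o \<mu>"
    using card_of_Plus_ordLess_infinite_Field[OF inf Co J\<mu> card_of_underS[OF Co b(1)]] .
  show ?thesis
  proof (cases "finite ?K")
    case True
    then have "finite J" "finite (underS \<mu> b)"
      by auto
    then have "finite (\<Union>j\<in>J. B j)"
      using bound card_of_ordLeq_finite by blast
    then show ?thesis
      using inf W finite_ordLess_infinite[OF card_of_Well_order W] by (metis Field_card_of)
  next
    case False
    have "|\<Union>j\<in>J. B j| \<le>o |?K|"
      using False card_of_Plus1 bound ordLeq_transitive[OF bound card_of_Plus2]
      by (intro card_of_UNION_ordLeq_infinite) auto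
    then show ?thesis
      using K ordLeq_ordLess_trans by blast
  qed
qed

section \<open>Covering \<mu> by small sets\<close>

lemma barely_independent_const:
  assumes "barely_independent \<kappa> \<mu> \<I>" and "\<A> \<subseteq> \<I>" and "|\<A>| =o \<kappa>"
  shows "|{x \<in> Field \<mu>. \<forall>A \<in> \<A>. (x \<in> A) = v}| <o \<mu>"
proof -
  \<comment> \<open>Exponent 0 keeps a set and 1 complements it, so a constant \<open>h\<close>
    expresses constant membership \<open>v\<close>.\<close>
  let ?i = "if v then 0 else 1 :: nat"
  have "{x \<in> Field \<mu>. \<forall>A \<in> \<A>. (x \<in> A) = v} =
      Inter_in (Field \<mu>) (family_power (Field \<mu>) \<A> (\<lambda>_. ?i))"
    by (auto simp: Inter_in_def family_power_def set_power_def)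
  moreover have "|Inter_in (Field \<mu>) (family_power (Field \<mu>) \<A> (\<lambda>_. ?i))| <o \<mu>"
  proof -
    have "\<A> \<in> subsets_of_card \<I> \<kappa>" "(\<lambda>_. ?i) \<in> \<A> \<rightarrow> {0, 1}"
      using assms by (auto simp: subsets_of_card_def)
    then show ?thesis
      using assms(1) unfolding barely_independent_def by blast
  qed
  ultimately show ?thesis
    by simp
qed

lemma cof_le_reaping_family:
  fixes \<kappa> :: "'k rel" and \<mu> :: "'m rel" and \<Lambda> :: "'l rel"
  assumes \<kappa>: "Cinfinite \<kappa>" and \<mu>: "Cinfinite \<mu>" and \<Lambda>: "Cinfinite \<Lambda>"
    and indep: "barely_independent \<kappa> \<mu> \<I>" and size: "|\<I>| =o \<Lambda>"
    and reap: "reaping_family \<kappa> \<Lambda> \<R>"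
  shows "cof \<mu> \<le>o |\<R>|"
proof (rule ccontr)
  assume contra: "\<not> cof \<mu> \<le>o |\<R>|"
  have "cof \<mu> \<in> card_of ` {A. A \<subseteq> Field \<mu> \<and> cofinal A \<mu>}"
    using min_size[of "{A. A \<subseteq> Field \<mu> \<and> cofinal A \<mu>}"] cofinal_Field[OF \<mu>]
    unfolding cof_def by blast
  then have "Well_order (cof \<mu>)"
    using card_of_Well_order by auto
  then have small: "|\<R>| <o cof \<mu>"
    using contra not_ordLeq_iff_ordLess card_of_Well_order by blast
  have infR: "infinite \<R>"
    by (rule reaping_family_infinite[OF \<kappa> \<Lambda> reap])
  \<comment> \<open>Reaping concerns index sets in \<open>Field \<Lambda>\<close>; the bijection
    \<phi> transfers them to subfamilies of \<I>, preserving size.\<close>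
  have "|Field \<Lambda>| =o |\<I>|"
    using \<Lambda> size card_of_Field_ordIso ordIso_transitive ordIso_symmetric by blast
  then obtain \<phi> where \<phi>: "bij_betw \<phi> (Field \<Lambda>) \<I>"
    using card_of_ordIso by blast
  have R: "R \<subseteq> Field \<Lambda>" "|R| =o \<kappa>" if "R \<in> \<R>" for R
    using that reap unfolding reaping_family_def subsets_of_card_def by blast+
  have "\<exists>P :: nat \<Rightarrow> 'l set. (\<forall>n. P n \<subseteq> R \<and> |P n| =o |R| ) \<and> (\<forall>m n. m \<noteq> n \<longrightarrow> P m \<inter> P n = {})"
    if "R \<in> \<R>" for R
  proof -
    have "|R| =o |Field \<kappa>|"
      using R(2)[OF that] \<kappa> ordIso_transitive[OF _ ordIso_symmetric[OF card_of_Field_ordIso]]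
      by blast
    then have "infinite R"
      using \<kappa> card_of_ordIso_finite unfolding cinfinite_def by blast
    then show ?thesis
      by (rule infinite_nat_partition) metis
  qed
  then obtain P :: "'l set \<Rightarrow> nat \<Rightarrow> 'l set" where
    P: "\<And>R n. R \<in> \<R> \<Longrightarrow> P R n \<subseteq> R" "\<And>R n. R \<in> \<R> \<Longrightarrow> |P R n| =o |R|"
       "\<And>R m n. R \<in> \<R> \<Longrightarrow> m \<noteq> n \<Longrightarrow> P R m \<inter> P R n = {}"
    by metis
  define B where "B = (\<lambda>(R, n, v). {x \<in> Field \<mu>. \<forall>A \<in> \<phi> ` P R n. (x \<in> A) = v})"
  let ?J = "\<R> \<times> (UNIV :: nat set) \<times> (UNIV :: bool set)"
  have "|UNIV :: nat set| \<le>o |\<R>|"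
    using infR infinite_iff_card_of_nat by blast
  moreover have "|UNIV :: bool set| \<le>o |\<R>|"
    using infR by (intro ordLess_imp_ordLeq finite_ordLess_infinite)
      (auto simp: Field_card_of card_of_well_order_on)
  ultimately have "|?J| \<le>o |\<R>|"
    using infR by (intro card_of_Sigma_ordLeq_infinite ballI) (auto simp: card_of_refl ordIso_imp_ordLeq)
  then have J: "|?J| <o cof \<mu>"
    using small ordLeq_ordLess_trans by blast
  have "|B j| <o \<mu>" if "j \<in> ?J" for j
  proof -
    obtain R n v where j: "j = (R, n, v)" "R \<in> \<R>"
      using \<open>j \<in> ?J\<close> by auto
    have sub: "P R n \<subseteq> Field \<Lambda>"
      using P(1) R(1) j(2) by blast
    then have "bij_betw \<phi> (P R n) (\<phi> ` P R n)"
      using bij_betw_subset[OF \<phi>] by simp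
    then have "|\<phi> ` P R n| =o |P R n|"
      by (rule ordIso_symmetric[OF card_of_ordIsoI])
    then have "|\<phi> ` P R n| =o \<kappa>"
      using ordIso_transitive[OF _ ordIso_transitive[OF P(2)[OF j(2)] R(2)[OF j(2)]]] by simp
    moreover have "\<phi> ` P R n \<subseteq> \<I>"
      using \<phi> sub by (auto simp: bij_betw_def)
    ultimately show ?thesis
      using barely_independent_const[OF indep, of "\<phi> ` P R n" v] j(1) by (simp add: B_def)
  qed
  then have lt: "|\<Union>j\<in>?J. B j| <o \<mu>"
    by (rule card_of_UNION_ordLess_cof[OF \<mu> J])
  have "Field \<mu> \<subseteq> (\<Union>j\<in>?J. B j)"
  proof
    fix x assume x: "x \<in> Field \<mu>"
    define S where "S = {i \<in> Field \<Lambda>. x \<in> \<phi> i}"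
    \<comment> \<open>Reaping families handle infinite \<open>S\<close>; a finite \<open>S\<close>
      splits nothing, so any member reaps it.\<close>
    have "\<exists>R \<in> \<R>. reaps R S"
    proof (cases "finite S")
      case True
      then have "reaps R S" for R
        unfolding reaps_def splits_def by blast
      then show ?thesis
        using infR by (metis all_not_in_conv finite.emptyI)
    next
      case False
      moreover have "S \<subseteq> Field \<Lambda>"
        by (auto simp: S_def)
      ultimately show ?thesis
        using reap unfolding reaping_family_def by blast
    qed
    then obtain R where RR: "R \<in> \<R>" and fin: "finite (R - S) \<or> finite (R \<inter> S)"
      unfolding reaps_def splits_def by blast
    then have "\<exists>n. P R n \<inter> (R - S) = {} \<or> P R n \<inter> (R \<inter> S) = {}"
      using finite_meets_finitely_many[of _ "P R"] P(3)[OF RR] by metis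
    then obtain n where "P R n \<subseteq> S \<or> P R n \<inter> S = {}"
      using P(1)[OF RR] by blast
    moreover have "P R n \<subseteq> Field \<Lambda>"
      using P(1) R(1) RR by blast
    \<comment> \<open>\<open>v\<close> is True if the piece lies in \<open>S\<close> and False if it
      avoids \<open>S\<close>.\<close>
    ultimately have "\<exists>v. \<forall>i \<in> P R n. (x \<in> \<phi> i) = v"
      unfolding S_def by blast
    then obtain v where "x \<in> B (R, n, v)"
      using x by (auto simp: B_def)
    then show "x \<in> (\<Union>j\<in>?J. B j)"
      using RR by blast
  qed
  then have "|Field \<mu>| <o \<mu>"
    using lt card_of_mono1 ordLeq_ordLess_trans by blast
  then show False
    using \<mu> not_ordLess_ordIso card_of_Field_ordIso by blast
qed

theorem theorem4p2:
  fixes \<kappa> :: "'k rel" and \<mu> :: "'m rel" and \<Lambda> :: "'l rel"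
  assumes "Cinfinite \<kappa>" and "Cinfinite \<mu>" and "Cinfinite \<Lambda>"
    and "\<kappa> \<le>o \<mu>"
    and "\<exists>\<I>. barely_independent \<kappa> \<mu> \<I> \<and> |\<I>| =o \<Lambda>"
  shows "cof \<mu> \<le>o reaping_number \<kappa> \<Lambda>"
proof -
  obtain \<I> where \<I>: "barely_independent \<kappa> \<mu> \<I>" "|\<I>| =o \<Lambda>"
    using assms by blast
  \<comment> \<open>This guarantees that some reaping family exists, so the minimum is
    attained.\<close>
  have "\<kappa> \<le>o \<Lambda>"
    using \<I> ordLeq_ordIso_trans unfolding barely_independent_def by blast
  then have "{\<R>. reaping_family \<kappa> \<Lambda> \<R>} \<noteq> {}"
    using reaping_family_all_subsets assms by blast
  then obtain \<R> where "reaping_family \<kappa> \<Lambda> \<R>" "reaping_number \<kappa> \<Lambda> = |\<R>|"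
    using min_size[of "{\<R>. reaping_family \<kappa> \<Lambda> \<R>}"] unfolding reaping_number_def by auto
  then show ?thesis
    using cof_le_reaping_family[OF assms(1-3) \<I>] by simp
qed

end
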